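(* Let $f(X)=a_nX^n+\cdots+a_1X+a_0$ be a polynomial with real coefficients, with $n\ge 1$ and $a_n>0$, and denote by $j_1<j_2<\cdots<j_\ell$ the indices $j$ for which $a_j<0$. Let $$v=\max_{1\le i\le \ell}\left(\frac{|a_{j_1}+a_{j_2}+\cdots+a_{j_\ell}|}{a_n}\right)^{\frac{1}{n-j_i}}.$$ Then $f$ has no zero in the sector $S_{v,\frac{\pi}{n}}$.
   Context: For real numbers $v,\theta$ with $0<\theta\le\pi$, define the open sector $S_{v,\theta}=\{z=v+\rho e^{i\varphi}\in\mathbb{C}:\rho>0,\ |\varphi|<\theta\}$ (with $\varphi$ real). If $f$ has no negative coefficients ($\ell=0$), the maximum over the empty set is understood to be $0$, i.e. $v=0$. *)

theory Defs
  imports "HOL-Computational_Algebra.Polynomial" Complex_Main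
begin

definition sector :: "real \<Rightarrow> real \<Rightarrow> complex set" where
  "sector v \<theta> =
     {complex_of_real v + complex_of_real \<rho> * exp (\<i> * complex_of_real \<phi>) | \<rho> \<phi> :: real.
        \<rho> > 0 \<and> \<bar>\<phi>\<bar> < \<theta>}"

definition neg_indices :: "real poly \<Rightarrow> nat set" where
  "neg_indices f = {j. coeff f j < 0}"

text \<open>The natural-number subtraction below does not truncate and the base of the power is
  positive in the intended case of a positive leading coefficient: then every index of a
  negative coefficient is smaller than the degree.\<close>

definition neg_bound :: "real poly \<Rightarrow> real" where
  "neg_bound f =
     (if neg_indices f = {} then 0
      else Max ((\<lambda>j. (\<bar>\<Sum>i\<in>neg_indices f. coeff f i\<bar> / lead_coeff f)
                       powr (1 / real (degree f - j))) ` neg_indices f))"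

end

theory Submission imports Defs
begin

text \<open>Put \<open>v = neg_bound f\<close>. By the choice of \<open>v\<close>, the leading term outweighs all the negative
  ones in every Taylor coefficient of \<open>f\<close> at \<open>v\<close>, so \<open>f (v + w)\<close> is a polynomial in \<open>w\<close> with
  nonnegative coefficients. For \<open>w\<close> with argument in \<open>(0, pi / n)\<close> all the powers
  \<open>w, \<dots>, w ^ n\<close> lie in the open upper half plane, and hence so does \<open>f (v + w)\<close>; negative
  arguments are symmetric, and for \<open>w > 0\<close> the value is positive.\<close>

text \<open>Expand each power of \<open>x + w\<close> by the binomial theorem and swap the two sums.
  The inner sum is the Taylor coefficient of \<open>p\<close> at \<open>x\<close>; its terms with
  \<open>j < k\<close> vanish with the binomial coefficient, so the truncated \<open>j - k\<close>
  does no harm.\<close>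

lemma poly_add_taylor:
  fixes p :: "'a :: comm_semiring_1 poly"
  shows "poly p (x + w) =
    (\<Sum>k\<le>degree p. (\<Sum>j\<le>degree p. of_nat (j choose k) * coeff p j * x ^ (j - k)) * w ^ k)"
proof -
  have "(x + w) ^ j = (\<Sum>k\<le>degree p. of_nat (j choose k) * w ^ k * x ^ (j - k))"
    if "j \<le> degree p" for j
  proof -
    have "(x + w) ^ j = (\<Sum>k\<le>j. of_nat (j choose k) * w ^ k * x ^ (j - k))"
      by (subst add.commute) (rule binomial_ring)
    also have "\<dots> = (\<Sum>k\<le>degree p. of_nat (j choose k) * w ^ k * x ^ (j - k))"
      using that by (intro sum.mono_neutral_left) (auto simp: binomial_eq_0)
    finally show ?thesis .
  qed
  then have "poly p (x + w) = (\<Sum>j\<le>degree p. \<Sum>k\<le>degree p.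
      of_nat (j choose k) * coeff p j * x ^ (j - k) * w ^ k)"
    by (auto simp: poly_altdef sum_distrib_left mult_ac intro!: sum.cong)
  also have "\<dots> = (\<Sum>k\<le>degree p. \<Sum>j\<le>degree p.
      of_nat (j choose k) * coeff p j * x ^ (j - k) * w ^ k)"
    by (rule sum.swap)
  finally show ?thesis by (simp add: sum_distrib_right)
qed

lemma nonneg_coeffs_no_zero_in_sector:
  fixes b :: "nat \<Rightarrow> real"
  assumes "n \<ge> 1" and nonneg: "\<And>k. k \<le> n \<Longrightarrow> b k \<ge> 0" and "b n > 0"
    and "\<rho> > 0" and "\<bar>\<phi>\<bar> < pi / real n"
  shows "(\<Sum>k\<le>n. complex_of_real (b k) * (complex_of_real \<rho> * cis \<phi>) ^ k) \<noteq> 0"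
    (is "?s \<noteq> 0")
proof (cases "\<phi> = 0")
  case True
  have "0 < (\<Sum>k\<le>n. b k * \<rho> ^ k)"
    using assms by (intro sum_pos2[of _ n]) auto
  moreover have "?s = complex_of_real (\<Sum>k\<le>n. b k * \<rho> ^ k)"
    using True by simp
  ultimately show ?thesis by (simp only: of_real_eq_0_iff)
next
  case False
  have small: "real k * \<bar>\<phi>\<bar> < pi" if "k \<le> n" for k
  proof -
    have "real k * \<bar>\<phi>\<bar> \<le> real n * \<bar>\<phi>\<bar>"
      using that by (intro mult_right_mono) auto
    also have "\<dots> < pi"
      using assms by (simp add: field_simps)
    finally show ?thesis .
  qed
  \<comment> \<open>Taking the absolute value of the angle treats both half planes at once: since
    sine is odd, this sum is the imaginary part up to the sign of \<open>\<phi>\<close>. Strictness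
    comes from the term \<open>k = n\<close>.\<close>
  have "0 < (\<Sum>k\<le>n. b k * \<rho> ^ k * sin (real k * \<bar>\<phi>\<bar>))"
  proof (rule sum_pos2[of _ n])
    show "0 < b n * \<rho> ^ n * sin (real n * \<bar>\<phi>\<bar>)"
      using False assms small[of n] by (intro mult_pos_pos sin_gt_zero) auto
    show "0 \<le> b k * \<rho> ^ k * sin (real k * \<bar>\<phi>\<bar>)" if "k \<in> {..n}" for k
      using that small[of k] nonneg[of k] \<open>\<rho> > 0\<close>
      by (intro mult_nonneg_nonneg sin_ge_zero) auto
  qed auto
  also have "\<dots> = sgn \<phi> * Im ?s"
    by (simp add: sum_distrib_left power_mult_distrib DeMoivre abs_real_def sgn_if mult.assoc
        flip: of_real_power)
  finally show ?thesis by (intro notI) simp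
qed

lemma finite_neg_indices: "finite (neg_indices f)"
  by (rule finite_subset[of _ "{..degree f}"]) (auto simp: neg_indices_def intro: le_degree)

lemma neg_indices_less_degree:
  assumes "lead_coeff f > 0" and "j \<in> neg_indices f"
  shows "j < degree f"
  using assms le_degree[of f j] by (cases "j = degree f") (auto simp: neg_indices_def)

lemma neg_bound_nonneg: "neg_bound f \<ge> 0"
proof (cases "neg_indices f = {}")
  case False
  then obtain j where "j \<in> neg_indices f" by blast
  then show ?thesis
    using False finite_neg_indices
    by (auto simp: neg_bound_def Max_ge_iff intro!: bexI[of _ j])
qed (simp add: neg_bound_def)

lemma sum_neg_coeffs_le:
  assumes lc: "lead_coeff f > 0" and j: "j \<in> neg_indices f"
  shows "\<bar>\<Sum>i\<in>neg_indices f. coeff f i\<bar> \<le> lead_coeff f * neg_bound f ^ (degree f - j)"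
proof -
  define q where "q = \<bar>\<Sum>i\<in>neg_indices f. coeff f i\<bar> / lead_coeff f"
  define d where "d = degree f - j"
  have "q \<ge> 0" using lc by (simp add: q_def)
  have "d > 0" using neg_indices_less_degree[OF assms] by (simp add: d_def)
  have "q powr (1 / real d) \<le> neg_bound f"
    using j finite_neg_indices by (auto simp: neg_bound_def q_def d_def intro!: Max_ge)
  then have "(q powr (1 / real d)) ^ d \<le> neg_bound f ^ d"
    by (rule power_mono) simp
  \<comment> \<open>\<open>powr_realpow\<close> asks for a positive base, so \<open>q = 0\<close> is
    split off; there both sides are 0 because \<open>d > 0\<close>.\<close>
  moreover have "(q powr (1 / real d)) ^ d = q"
    using \<open>d > 0\<close> \<open>q \<ge> 0\<close> by (cases "q = 0") (auto simp: powr_powr simp flip: powr_realpow)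
  ultimately show ?thesis
    using lc by (simp add: q_def d_def field_simps)
qed

text \<open>The leading term \<open>T n\<close> is shared out among the negative coefficients in
  proportion to their absolute values. The shares \<open>\<bar>coeff f j\<bar> / S\<close> add up to
  1, and each share covers the negative term \<open>T j\<close> assigned to it.\<close>

lemma taylor_coeff_neg_bound_nonneg:
  assumes lc: "lead_coeff f > 0" and "k \<le> degree f"
  defines "v \<equiv> neg_bound f"
  shows "0 \<le> (\<Sum>j\<le>degree f. real (j choose k) * coeff f j * v ^ (j - k))"
proof -
  define n where "n = degree f"
  define N where "N = neg_indices f"
  define S where "S = (\<Sum>i\<in>N. \<bar>coeff f i\<bar>)"
  define T where "T j = real (j choose k) * coeff f j * v ^ (j - k)" for j
  have v: "v \<ge> 0" by (simp add: v_def neg_bound_nonneg)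
  have N: "finite N" "\<And>j. j \<in> N \<Longrightarrow> j < n" "n \<notin> N" "\<And>j. j \<notin> N \<Longrightarrow> coeff f j \<ge> 0"
    using neg_indices_less_degree[OF lc] finite_neg_indices
    by (force simp: N_def n_def neg_indices_def)+
  have S_nonneg: "S \<ge> 0" unfolding S_def by (simp add: sum_nonneg)
  have "S = - (\<Sum>i\<in>N. coeff f i)"
    unfolding S_def sum_negf[symmetric]
    by (rule sum.cong) (auto simp: N_def neg_indices_def)
  then have S_abs: "S = \<bar>\<Sum>i\<in>N. coeff f i\<bar>"
    using S_nonneg by simp
  \<comment> \<open>The share estimate, multiplied by \<open>S\<close> to avoid a division. For
    \<open>k \<le> j\<close> it combines the bound on \<open>S\<close> from
    \<open>sum_neg_coeffs_le\<close> with the monotonicity of \<open>j choose k\<close> in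
    \<open>j\<close>; for \<open>k > j\<close> the term \<open>T j\<close> is 0.\<close>
  have T_neg: "S * - T j \<le> \<bar>coeff f j\<bar> * T n" if j: "j \<in> N" for j
  proof (cases "k \<le> j")
    case True
    have jn: "j < n" using N j by blast
    have "S * v ^ (j - k) \<le> coeff f n * v ^ (n - j) * v ^ (j - k)"
      using sum_neg_coeffs_le[OF lc, of j] j v
      by (intro mult_right_mono) (auto simp: S_abs N_def n_def v_def)
    also have "\<dots> = coeff f n * v ^ (n - k)"
      using True jn by (simp add: power_add[symmetric])
    finally have "real (j choose k) * (S * v ^ (j - k))
        \<le> real (n choose k) * (coeff f n * v ^ (n - k))"
      using jn S_nonneg v by (intro mult_mono[of "real (j choose k)"]) (auto intro: binomial_right_mono)
    then have "\<bar>coeff f j\<bar> * (real (j choose k) * (S * v ^ (j - k)))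
        \<le> \<bar>coeff f j\<bar> * (real (n choose k) * (coeff f n * v ^ (n - k)))"
      by (rule mult_left_mono) simp
    moreover have "\<bar>coeff f j\<bar> = - coeff f j"
      using j by (simp add: N_def neg_indices_def)
    ultimately show ?thesis by (simp add: T_def mult_ac)
  next
    case False
    then show ?thesis using lc v by (simp add: T_def n_def binomial_eq_0)
  qed
  have "0 \<le> T n + (\<Sum>j\<in>N. T j)"
  \<comment> \<open>Without negative coefficients \<open>S\<close> is 0 and could not be cancelled
    below.\<close>
  proof (cases "N = {}")
    case True
    then show ?thesis using lc v by (simp add: T_def n_def)
  next
    case False
    then have "S > 0"
      unfolding S_def using N(1) by (intro sum_pos) (auto simp: N_def neg_indices_def)
    have "(\<Sum>j\<in>N. S * - T j) \<le> (\<Sum>j\<in>N. \<bar>coeff f j\<bar> * T n)"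
      using T_neg by (rule sum_mono)
    then have "0 \<le> S * (T n + (\<Sum>j\<in>N. T j))"
      by (simp add: S_def sum_negf sum_distrib_right[symmetric] sum_distrib_left[symmetric]
          distrib_left)
    then show ?thesis using \<open>S > 0\<close> by (simp add: zero_le_mult_iff)
  qed
  also have "\<dots> = (\<Sum>j\<in>insert n N. T j)"
    using N by simp
  \<comment> \<open>The indices added here have nonnegative coefficients, and \<open>v\<close> is
    nonnegative.\<close>
  also have "\<dots> \<le> (\<Sum>j\<le>n. T j)"
    using N v by (intro sum_mono2) (auto simp: T_def intro: less_imp_le)
  finally show ?thesis by (simp add: T_def n_def)
qed

theorem theorem2p5:
  fixes f :: "real poly" and n :: nat
  assumes "degree f = n" and "n \<ge> 1" and "coeff f n > 0"
  shows "\<forall>z \<in> sector (neg_bound f) (pi / real n). poly (map_poly complex_of_real f) z \<noteq> 0"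
proof
  fix z assume "z \<in> sector (neg_bound f) (pi / real n)"
  then obtain \<rho> \<phi> where \<rho>: "\<rho> > 0" and \<phi>: "\<bar>\<phi>\<bar> < pi / real n"
    and z: "z = complex_of_real (neg_bound f) + complex_of_real \<rho> * cis \<phi>"
    by (auto simp: sector_def cis_conv_exp)
  define b where
    "b k = (\<Sum>j\<le>n. real (j choose k) * coeff f j * neg_bound f ^ (j - k))" for k
  \<comment> \<open>Nonnegativity alone would allow all \<open>b k\<close> to vanish; the top one is
    strictly positive, as only \<open>j = n\<close> contributes to it.\<close>
  have "b n = coeff f n"
  proof -
    have "b n = (\<Sum>j\<in>{n}. real (j choose n) * coeff f j * neg_bound f ^ (j - n))"
      unfolding b_def by (rule sum.mono_neutral_right) (auto simp: binomial_eq_0)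
    then show ?thesis by simp
  qed
  moreover have "b k \<ge> 0" if "k \<le> n" for k
    using taylor_coeff_neg_bound_nonneg[of f k] assms that by (simp add: b_def)
  ultimately have
    "(\<Sum>k\<le>n. complex_of_real (b k) * (complex_of_real \<rho> * cis \<phi>) ^ k) \<noteq> 0"
    using assms \<rho> \<phi> by (intro nonneg_coeffs_no_zero_in_sector) auto
  moreover have "degree (map_poly complex_of_real f) = n"
    using assms(1) by (simp add: degree_map_poly)
  ultimately show "poly (map_poly complex_of_real f) z \<noteq> 0"
    unfolding z poly_add_taylor by (simp add: b_def coeff_map_poly)
qed

end
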